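(* Let $G$ be a simple graph with distinct vertices $x,y\in V(G)$ such that $\{x,y\}\notin E(G)$. Let $\widehat{G}$ be the graph with $V(\widehat{G})=V(G)$ and $E(\widehat{G})=E(G)\cup\{\{x,y\}\}$. Then the following are equivalent: (1) In the graph $\widehat{G}$, the edge $\{x,y\}$ has Property $P$. (2) The elements $x+y$ and $x-y$ are regular elements of $R/I(G)$. (3) The elements $x+y$ and $x-y$ are regular elements of $R/I(\widehat{G})$. (4) For any associated prime $Q$ of $R/I(G)$ the element $xy$ is not an element of $Q^2$. (5) For any associated prime $Q$ of $R/I(\widehat{G})$ the element $xy$ is not an element of $Q^2$. (6) No minimal vertex cover of $G$ contains the set $\{x,y\}$. (7) No minimal vertex cover of $\widehat{G}$ contains the set $\{x,y\}$.
   Context: All graphs are finite. For a simple graph $G$, let $k$ be a field and $R$ the polynomial ring over $k$ with variables the vertices of $G$. The edge ideal is $I(G)=\langle uv \mid \{u,v\}\in E(G)\rangle\subseteq R$. A vertex cover of $G$ is a set $X\subseteq V(G)$ such that every edge of $G$ contains a vertex of $X$; minimal means minimal under inclusion. A regular element is a nonzerodivisor. Property $P$: an edge $\{x,y\}$ of a simple graph $H$ has Property $P$ if for any $a,b\in V(H)$ with $\{a,x\},\{y,b\}\in E(H)$ we have $a\neq b$ and $\{a,b\}\in E(H)$. *)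

theory Defs
  imports "HOL-Algebra.Algebra" "HOL-Library.Poly_Mapping"
begin

section \<open>Finite simple graphs\<close>

definition simple_graph :: "'v set \<Rightarrow> 'v set set \<Rightarrow> bool" where
  "simple_graph V E \<longleftrightarrow> finite V \<and> (\<forall>e\<in>E. e \<subseteq> V \<and> card e = 2)"

definition vertex_cover :: "'v set \<Rightarrow> 'v set set \<Rightarrow> 'v set \<Rightarrow> bool" where
  "vertex_cover V E C \<longleftrightarrow> C \<subseteq> V \<and> (\<forall>e\<in>E. \<exists>v\<in>C. v \<in> e)"

definition minimal_vertex_cover :: "'v set \<Rightarrow> 'v set set \<Rightarrow> 'v set \<Rightarrow> bool" where
  "minimal_vertex_cover V E C \<longleftrightarrow>
     vertex_cover V E C \<and> (\<forall>Y. vertex_cover V E Y \<and> Y \<subseteq> C \<longrightarrow> Y = C)"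

text \<open>The condition is symmetric in \<open>x\<close> and \<open>y\<close>, so it depends only on the edge \<open>{x, y}\<close>.\<close>

definition property_P :: "'v set \<Rightarrow> 'v set set \<Rightarrow> 'v \<Rightarrow> 'v \<Rightarrow> bool" where
  "property_P V E x y \<longleftrightarrow> {x, y} \<in> E \<and>
     (\<forall>a\<in>V. \<forall>b\<in>V. {a, x} \<in> E \<and> {y, b} \<in> E \<longrightarrow> a \<noteq> b \<and> {a, b} \<in> E)"


section \<open>Polynomial rings and edge ideals\<close>

text \<open>
  A monomial is a finitely supported exponent vector and a polynomial a finitely supported
  map from monomials to coefficients; multiplication on this type is convolution. The carrier
  consists of the polynomials all of whose variables lie in \<open>V\<close>.
\<close>

definition mpoly_ring :: "'v set \<Rightarrow> (('v \<Rightarrow>\<^sub>0 nat) \<Rightarrow>\<^sub>0 'k::field) ring" where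
  "mpoly_ring V =
     \<lparr>carrier = {p. \<forall>m\<in>Poly_Mapping.keys p. Poly_Mapping.keys m \<subseteq> V},
      monoid.mult = (*), one = 1, ring.zero = 0, add = (+)\<rparr>"

definition poly_var :: "'v \<Rightarrow> ('v \<Rightarrow>\<^sub>0 nat) \<Rightarrow>\<^sub>0 'k::field" where
  "poly_var v = Poly_Mapping.single (Poly_Mapping.single v 1) 1"

definition edge_ideal :: "'v set \<Rightarrow> 'v set set \<Rightarrow> (('v \<Rightarrow>\<^sub>0 nat) \<Rightarrow>\<^sub>0 'k::field) set" where
  "edge_ideal V E = Idl\<^bsub>mpoly_ring V\<^esub> {poly_var u * poly_var v | u v. {u, v} \<in> E}"

lemma cring_mpoly_ring: "cring (mpoly_ring V :: (('v \<Rightarrow>\<^sub>0 nat) \<Rightarrow>\<^sub>0 'k::field) ring)"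
proof (intro cringI abelian_groupI comm_monoidI)
  fix p :: "('v \<Rightarrow>\<^sub>0 nat) \<Rightarrow>\<^sub>0 'k"
  assume "p \<in> carrier (mpoly_ring V)"
  then show "\<exists>q\<in>carrier (mpoly_ring V). q \<oplus>\<^bsub>mpoly_ring V\<^esub> p = \<zero>\<^bsub>mpoly_ring V\<^esub>"
    by (intro bexI[of _ "- p"]) (auto simp: mpoly_ring_def in_keys_iff)
next
  fix p q :: "('v \<Rightarrow>\<^sub>0 nat) \<Rightarrow>\<^sub>0 'k"
  assume pq: "p \<in> carrier (mpoly_ring V)" "q \<in> carrier (mpoly_ring V)"
  have "Poly_Mapping.keys m \<subseteq> V"
    if m: "m \<in> Poly_Mapping.keys (p * q)" for m :: "'v \<Rightarrow>\<^sub>0 nat"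
  proof -
    obtain a b where "a \<in> Poly_Mapping.keys p" "b \<in> Poly_Mapping.keys q" "m = a + b"
      using m keys_mult[of p q] by blast
    then show ?thesis
      using pq keys_add[of a b] by (fastforce simp: mpoly_ring_def)
  qed
  then show "p \<otimes>\<^bsub>mpoly_ring V\<^esub> q \<in> carrier (mpoly_ring V)"
    by (simp add: mpoly_ring_def)
  show "p \<oplus>\<^bsub>mpoly_ring V\<^esub> q \<in> carrier (mpoly_ring V)"
    using pq keys_add[of p q] by (auto simp: mpoly_ring_def)
qed (auto simp: mpoly_ring_def algebra_simps)

lemma poly_var_in_carrier: "v \<in> V \<Longrightarrow> poly_var v \<in> carrier (mpoly_ring V)"
  by (simp add: mpoly_ring_def poly_var_def)


section \<open>Regular elements and associated primes\<close>

definition regular_element :: "('a, 'b) ring_scheme \<Rightarrow> 'a \<Rightarrow> bool" where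
  "regular_element A a \<longleftrightarrow>
     a \<in> carrier A \<and> (\<forall>b\<in>carrier A. a \<otimes>\<^bsub>A\<^esub> b = \<zero>\<^bsub>A\<^esub> \<longrightarrow> b = \<zero>\<^bsub>A\<^esub>)"

text \<open>The quotient \<open>R/I\<close> as an \<open>R\<close>-module, so that its associated primes are ideals of \<open>R\<close>.\<close>

definition quot_module :: "('a, 'b) ring_scheme \<Rightarrow> 'a set \<Rightarrow> ('a, 'a set) module" where
  "quot_module R I =
     \<lparr>carrier = carrier (R Quot I), monoid.mult = monoid.mult (R Quot I), one = one (R Quot I),
      ring.zero = ring.zero (R Quot I), add = add (R Quot I),
      smult = (\<lambda>r m. (I +>\<^bsub>R\<^esub> r) \<otimes>\<^bsub>R Quot I\<^esub> m)\<rparr>"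

definition associated_prime ::
    "('a, 'b) ring_scheme \<Rightarrow> ('a, 'm, 'c) module_scheme \<Rightarrow> 'a set \<Rightarrow> bool" where
  "associated_prime R M Q \<longleftrightarrow> primeideal Q R \<and>
     (\<exists>m\<in>carrier M. Q = {r \<in> carrier R. r \<odot>\<^bsub>M\<^esub> m = \<zero>\<^bsub>M\<^esub>})"


section \<open>Equivalence of a list of statements\<close>

definition all_equivalent :: "bool list \<Rightarrow> bool" where
  "all_equivalent Ps \<longleftrightarrow> (\<forall>P\<in>set Ps. \<forall>Q\<in>set Ps. P \<longleftrightarrow> Q)"

end

theory Submission
  imports Defs
begin

text \<open>
  A minimal vertex cover \<open>C\<close> of a graph with edge ideal \<open>I\<close> gives the ideal \<open>P\<^sub>C\<close> generated by the
  variables in \<open>C\<close>, which consists of the polynomials all of whose monomials involve a vertex of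
  \<open>C\<close>. Everything about \<open>R/I\<close> that matters here follows from three facts.

  \<^item> \<open>P\<^sub>C\<close> is prime (\<open>primeideal_cover_prime\<close>).
  \<^item> \<open>I\<close> is the intersection of the \<open>P\<^sub>C\<close> (\<open>edge_ideal_subset_cover_prime\<close>,
    \<open>not_in_edge_ideal_imp_minimal_cover\<close>): a monomial outside \<open>I\<close> has an independent support, and
    the complement of that support contains a minimal vertex cover.
  \<^item> \<open>P\<^sub>C\<close> is the annihilator modulo \<open>I\<close> of the product of the variables outside \<open>C\<close>
    (\<open>annihilator_of_complement_monomial\<close>): minimality gives every vertex of \<open>C\<close> a neighbour
    outside \<open>C\<close>. So \<open>P\<^sub>C\<close> is an associated prime, and its elements are zero divisors on \<open>R/I\<close>.

  If a minimal cover \<open>C\<close> contains \<open>x\<close> and \<open>y\<close>, then \<open>x + y\<close> and \<open>x - y\<close> lie in \<open>P\<^sub>C\<close> and are not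
  regular, and \<open>xy\<close> lies in \<open>P\<^sub>C\<^sup>2\<close>. Conversely, suppose that \<open>r f \<in> I\<close> and \<open>f \<notin> I\<close>. Then \<open>f \<notin> P\<^sub>C\<close> for
  some minimal cover \<open>C\<close>, so \<open>r \<in> P\<^sub>C\<close>. If \<open>r\<close> is \<open>x + y\<close> or \<open>x - y\<close>, this puts \<open>x\<close> and \<open>y\<close> in
  \<open>C\<close>. It also shows that every associated prime \<open>Q\<close> is contained in some \<open>P\<^sub>C\<close>, and
  \<open>xy \<in> P\<^sub>C\<^sup>2\<close> again forces \<open>x\<close> and \<open>y\<close> into \<open>C\<close>. This proves that the conditions on regular elements
  and on associated primes say, for an arbitrary graph, that no minimal cover contains both \<open>x\<close> and
  \<open>y\<close>.

  What remains is combinatorial. A cover is minimal iff each of its vertices has a neighbour outside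
  it. Given \<open>x, y \<in> C\<close>, the edge \<open>{x, y}\<close> has no influence on that criterion, so \<open>G\<close> and
  the graph with the added edge have the same minimal covers containing \<open>x\<close> and \<open>y\<close>. Such a cover
  provides neighbours \<open>a\<close> of \<open>x\<close> and \<open>b\<close> of \<open>y\<close> outside itself, which are equal or not adjacent;
  conversely, a minimal cover avoiding such \<open>a\<close> and \<open>b\<close> must contain \<open>x\<close> and \<open>y\<close>. So such a
  cover exists iff Property \<open>P\<close> fails.
\<close>

section \<open>Minimal vertex covers\<close>

lemma vertex_cover_edgeD:
  "vertex_cover V E C \<Longrightarrow> {u, v} \<in> E \<Longrightarrow> u \<in> C \<or> v \<in> C"
  by (auto simp: vertex_cover_def)

lemma simple_graph_edge:
  assumes "simple_graph V E" and "e \<in> E"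
  obtains u v where "e = {u, v}" "u \<noteq> v" "u \<in> V" "v \<in> V"
proof -
  have e: "e \<subseteq> V" "card e = 2"
    using assms by (auto simp: simple_graph_def)
  then obtain u v where "e = {u, v}" "u \<noteq> v"
    by (auto simp: card_2_iff)
  then show ?thesis
    using e that by auto
qed

lemma simple_graph_edgeD:
  assumes "simple_graph V E" and "{u, v} \<in> E"
  shows "u \<noteq> v" "u \<in> V" "v \<in> V"
  using assms by (auto simp: simple_graph_def)

text \<open>
  A vertex can be dropped from a cover unless one of its edges is covered by it alone, so minimality
  is a condition on each vertex separately.
\<close>

lemma minimal_vertex_cover_iff_private_edge:
  assumes G: "simple_graph V E"
  shows "minimal_vertex_cover V E C \<longleftrightarrow>
    vertex_cover V E C \<and> (\<forall>v\<in>C. \<exists>u\<in>V - C. {u, v} \<in> E)"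
proof
  assume min: "minimal_vertex_cover V E C"
  then have C: "vertex_cover V E C"
    by (simp add: minimal_vertex_cover_def)
  have "\<exists>u\<in>V - C. {u, v} \<in> E" if "v \<in> C" for v
  proof (rule ccontr)
    assume none: "\<not> (\<exists>u\<in>V - C. {u, v} \<in> E)"
    have "\<exists>w\<in>C - {v}. w \<in> e" if e: "e \<in> E" for e
    proof -
      obtain a b where ab: "e = {a, b}" "a \<noteq> b" "a \<in> V" "b \<in> V"
        using simple_graph_edge[OF G e] by blast
      have "a \<in> C \<or> b \<in> C"
        using vertex_cover_edgeD[OF C] ab e by blast
      moreover have "a = v \<longrightarrow> b \<in> C" "b = v \<longrightarrow> a \<in> C"
        using none ab e by (auto simp: insert_commute)
      ultimately show ?thesis
        using ab by blast
    qed
    then have "vertex_cover V E (C - {v})"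
      using C by (auto simp: vertex_cover_def)
    then have "C - {v} = C"
      using min by (auto simp: minimal_vertex_cover_def)
    then show False
      using \<open>v \<in> C\<close> by blast
  qed
  then show "vertex_cover V E C \<and> (\<forall>v\<in>C. \<exists>u\<in>V - C. {u, v} \<in> E)"
    using C by blast
next
  assume C: "vertex_cover V E C \<and> (\<forall>v\<in>C. \<exists>u\<in>V - C. {u, v} \<in> E)"
  have "Y = C" if Y: "vertex_cover V E Y" "Y \<subseteq> C" for Y
  proof -
    have "v \<in> Y" if "v \<in> C" for v
    proof -
      obtain u where "u \<in> V - C" "{u, v} \<in> E"
        using C \<open>v \<in> C\<close> by blast
      then show ?thesis
        using vertex_cover_edgeD[OF Y(1)] Y(2) by blast
    qed
    then show ?thesis
      using Y(2) by blast
  qed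
  then show "minimal_vertex_cover V E C"
    using C by (simp add: minimal_vertex_cover_def)
qed

lemma vertex_cover_contains_minimal:
  assumes "simple_graph V E" and "vertex_cover V E D"
  obtains C where "minimal_vertex_cover V E C" "C \<subseteq> D"
proof -
  let ?S = "{Y. vertex_cover V E Y \<and> Y \<subseteq> D}"
  have "finite D"
    using assms finite_subset by (auto simp: simple_graph_def vertex_cover_def)
  then have "finite ?S"
    by (intro finite_subset[of ?S "Pow D"]) auto
  moreover have "?S \<noteq> {}"
    using assms by blast
  ultimately have "\<exists>C\<in>?S. \<forall>Y\<in>?S. Y \<subseteq> C \<longrightarrow> C = Y"
    by (rule finite_has_minimal)
  then obtain C where "C \<in> ?S" "\<forall>Y\<in>?S. Y \<subseteq> C \<longrightarrow> C = Y"
    by (rule bexE)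
  then show ?thesis
    by (intro that[of C]) (auto simp: minimal_vertex_cover_def)
qed

text \<open>
  When \<open>x\<close> and \<open>y\<close> both belong to \<open>C\<close>, the edge \<open>{x, y}\<close> is covered and joins no vertex of \<open>C\<close> to
  a vertex outside \<open>C\<close>.
\<close>

lemma ex_minimal_cover_add_edge_iff:
  assumes G: "simple_graph V E" and "x \<in> V" "y \<in> V" "x \<noteq> y"
  shows "(\<exists>C. minimal_vertex_cover V (insert {x, y} E) C \<and> {x, y} \<subseteq> C) \<longleftrightarrow>
    (\<exists>C. minimal_vertex_cover V E C \<and> {x, y} \<subseteq> C)"
proof -
  have G': "simple_graph V (insert {x, y} E)"
    using assms by (auto simp: simple_graph_def)
  have "minimal_vertex_cover V (insert {x, y} E) C \<longleftrightarrow> minimal_vertex_cover V E C"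
    if xy: "{x, y} \<subseteq> C" for C
  proof -
    have "vertex_cover V (insert {x, y} E) C \<longleftrightarrow> vertex_cover V E C"
      using xy by (auto simp: vertex_cover_def)
    moreover have "{u, v} \<in> insert {x, y} E \<longleftrightarrow> {u, v} \<in> E" if "u \<in> V - C" for u v
      using xy that by (auto simp: doubleton_eq_iff)
    ultimately show ?thesis
      by (simp add: minimal_vertex_cover_iff_private_edge[OF G]
          minimal_vertex_cover_iff_private_edge[OF G'])
  qed
  then show ?thesis
    by blast
qed

text \<open>
  A minimal cover containing \<open>x\<close> and \<open>y\<close> leaves out neighbours of both, and vertices outside a cover
  are never adjacent. Conversely, the vertices other than two equal or nonadjacent ones \<open>a\<close>, \<open>b\<close> form
  a cover, and every minimal cover inside it contains all neighbours of \<open>a\<close> and \<open>b\<close>.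
\<close>

lemma property_P_iff_no_minimal_cover:
  assumes G: "simple_graph V E" and xy: "{x, y} \<in> E"
  shows "property_P V E x y \<longleftrightarrow> \<not> (\<exists>C. minimal_vertex_cover V E C \<and> {x, y} \<subseteq> C)"
proof
  assume P: "property_P V E x y"
  show "\<not> (\<exists>C. minimal_vertex_cover V E C \<and> {x, y} \<subseteq> C)"
  proof
    assume "\<exists>C. minimal_vertex_cover V E C \<and> {x, y} \<subseteq> C"
    then obtain C where C: "vertex_cover V E C" "\<And>v. v \<in> C \<Longrightarrow> \<exists>u\<in>V - C. {u, v} \<in> E" "{x, y} \<subseteq> C"
      using minimal_vertex_cover_iff_private_edge[OF G] by blast
    obtain a b where "a \<in> V - C" "{a, x} \<in> E" "b \<in> V - C" "{b, y} \<in> E"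
      using C(2)[of x] C(2)[of y] C(3) by blast
    moreover from this have "{a, b} \<in> E"
      using P by (auto simp: property_P_def insert_commute)
    ultimately show False
      using vertex_cover_edgeD[OF C(1)] by blast
  qed
next
  assume none: "\<not> (\<exists>C. minimal_vertex_cover V E C \<and> {x, y} \<subseteq> C)"
  have "a \<noteq> b \<and> {a, b} \<in> E" if ab: "{a, x} \<in> E" "{y, b} \<in> E" for a b
  proof (rule ccontr)
    assume bad: "\<not> (a \<noteq> b \<and> {a, b} \<in> E)"
    have nab: "{a, b} \<notin> E"
      using bad simple_graph_edgeD(1)[OF G, of a b] by blast
    have "\<exists>v\<in>V - {a, b}. v \<in> e" if e: "e \<in> E" for e
    proof -
      obtain c d where cd: "e = {c, d}" "c \<noteq> d" "c \<in> V" "d \<in> V"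
        using simple_graph_edge[OF G e] by blast
      have "{c, d} \<noteq> {a, b}"
        using nab cd(1) e by metis
      then show ?thesis
        using cd by auto
    qed
    then have "vertex_cover V E (V - {a, b})"
      by (auto simp: vertex_cover_def)
    then obtain C where C: "minimal_vertex_cover V E C" "C \<subseteq> V - {a, b}"
      using vertex_cover_contains_minimal[OF G] by blast
    have "x \<in> C" "y \<in> C"
      using C ab vertex_cover_edgeD[of V E C] by (auto simp: minimal_vertex_cover_def)
    then show False
      using none C by blast
  qed
  then show "property_P V E x y"
    using xy by (auto simp: property_P_def)
qed


section \<open>Products of polynomials\<close>

text \<open>
  The product of two polynomials is controlled through a single monomial that arises in only one
  way. It is found by maximising the exponent of one variable after the other: the type of
  variables carries no linear order that would single out a leading monomial.
\<close>

lemma unique_product_of_exponents: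
  fixes A B :: "('v \<Rightarrow>\<^sub>0 nat) set"
  assumes "finite S" "finite A" "A \<noteq> {}" "finite B" "B \<noteq> {}"
    and "\<And>a a' v. a \<in> A \<Longrightarrow> a' \<in> A \<Longrightarrow> v \<notin> S \<Longrightarrow>
      Poly_Mapping.lookup a v = Poly_Mapping.lookup a' v"
    and "\<And>b b' v. b \<in> B \<Longrightarrow> b' \<in> B \<Longrightarrow> v \<notin> S \<Longrightarrow>
      Poly_Mapping.lookup b v = Poly_Mapping.lookup b' v"
  shows "\<exists>a\<in>A. \<exists>b\<in>B. \<forall>a'\<in>A. \<forall>b'\<in>B. a' + b' = a + b \<longrightarrow> a' = a \<and> b' = b"
  using assms
proof (induction S arbitrary: A B rule: finite_induct)
  case empty
  obtain a b where ab: "a \<in> A" "b \<in> B"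
    using empty by blast
  have "a' = a" if "a' \<in> A" for a'
    using empty.prems(5)[OF that ab(1)] by (intro poly_mapping_eqI) auto
  moreover have "b' = b" if "b' \<in> B" for b'
    using empty.prems(6)[OF that ab(2)] by (intro poly_mapping_eqI) auto
  ultimately show ?case
    using ab by blast
next
  case (insert s S)
  let ?exp = "\<lambda>m. Poly_Mapping.lookup m s"
  define M N where "M = Max (?exp ` A)" and "N = Max (?exp ` B)"
  have M: "M \<in> ?exp ` A" "\<And>a. a \<in> A \<Longrightarrow> ?exp a \<le> M"
    and N: "N \<in> ?exp ` B" "\<And>b. b \<in> B \<Longrightarrow> ?exp b \<le> N"
    using insert.prems by (auto simp: M_def N_def intro!: Max_in)
  define A' B' where "A' = {a\<in>A. ?exp a = M}" and "B' = {b\<in>B. ?exp b = N}"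
  have "\<exists>a\<in>A'. \<exists>b\<in>B'. \<forall>a'\<in>A'. \<forall>b'\<in>B'. a' + b' = a + b \<longrightarrow> a' = a \<and> b' = b"
  proof (rule insert.IH)
    show "finite A'" "finite B'"
      using insert.prems by (auto simp: A'_def B'_def)
    show "A' \<noteq> {}" "B' \<noteq> {}"
      using M(1) N(1) by (auto simp: A'_def B'_def)
    show "Poly_Mapping.lookup a v = Poly_Mapping.lookup a' v"
      if "a \<in> A'" "a' \<in> A'" "v \<notin> S" for a a' v
      using that insert.prems(5)[of a a' v] by (cases "v = s") (auto simp: A'_def)
    show "Poly_Mapping.lookup b v = Poly_Mapping.lookup b' v"
      if "b \<in> B'" "b' \<in> B'" "v \<notin> S" for b b' v
      using that insert.prems(6)[of b b' v] by (cases "v = s") (auto simp: B'_def)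
  qed
  then obtain a b where ab: "a \<in> A'" "b \<in> B'"
    and uniq: "\<And>a' b'. a' \<in> A' \<Longrightarrow> b' \<in> B' \<Longrightarrow> a' + b' = a + b \<Longrightarrow> a' = a \<and> b' = b"
    by blast
  have "a' = a \<and> b' = b" if "a' \<in> A" "b' \<in> B" "a' + b' = a + b" for a' b'
  proof -
    have "?exp a' + ?exp b' = M + N"
      using arg_cong[OF that(3), of ?exp] ab by (simp add: lookup_add A'_def B'_def)
    then have "?exp a' = M" "?exp b' = N"
      using M(2)[OF that(1)] N(2)[OF that(2)] by linarith+
    then show ?thesis
      using uniq that by (simp add: A'_def B'_def)
  qed
  then show ?case
    using ab by (auto simp: A'_def B'_def)
qed

lemma lookup_mult_of_unique_product:
  fixes p q :: "('v \<Rightarrow>\<^sub>0 nat) \<Rightarrow>\<^sub>0 'k::field"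
  assumes uniq: "\<And>a' b'. a' \<in> Poly_Mapping.keys p \<Longrightarrow> b' \<in> Poly_Mapping.keys q \<Longrightarrow>
      a' + b' = a + b \<Longrightarrow> a' = a"
  shows "Poly_Mapping.lookup (p * q) (a + b) = Poly_Mapping.lookup p a * Poly_Mapping.lookup q b"
proof -
  have "Poly_Mapping.lookup p l * (\<Sum>m. Poly_Mapping.lookup q m when a + b = l + m) =
      (Poly_Mapping.lookup p a * Poly_Mapping.lookup q b when l = a)" for l
  proof (cases "l = a")
    case True
    then show ?thesis
      by simp
  next
    case False
    have "Poly_Mapping.lookup p l * (\<Sum>m. Poly_Mapping.lookup q m when a + b = l + m) = 0"
    proof (cases "l \<in> Poly_Mapping.keys p")
      case True
      then have "(Poly_Mapping.lookup q m when a + b = l + m) = 0" for m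
        using uniq[of l m] False by (cases "m \<in> Poly_Mapping.keys q") (auto simp: when_def in_keys_iff)
      then show ?thesis
        by simp
    qed (simp add: in_keys_iff)
    then show ?thesis
      using False by simp
  qed
  then show ?thesis
    by (simp add: lookup_mult)
qed

lemma keys_add_exponents:
  fixes a b :: "'v \<Rightarrow>\<^sub>0 nat"
  shows "Poly_Mapping.keys (a + b) = Poly_Mapping.keys a \<union> Poly_Mapping.keys b"
  by (auto simp: in_keys_iff lookup_add)

lemma keys_multE:
  fixes p q :: "('v \<Rightarrow>\<^sub>0 nat) \<Rightarrow>\<^sub>0 'k::field"
  assumes "m \<in> Poly_Mapping.keys (p * q)"
  obtains a b where "a \<in> Poly_Mapping.keys p" "b \<in> Poly_Mapping.keys q" "m = a + b"
  using assms keys_mult[of p q] by blast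

text \<open>
  Setting the variables in \<open>C\<close> to zero keeps exactly the monomials avoiding \<open>C\<close>. The lemma expresses
  that the ring of polynomials in the remaining variables is a domain.
\<close>

lemma keys_mult_avoiding:
  fixes p q :: "('v \<Rightarrow>\<^sub>0 nat) \<Rightarrow>\<^sub>0 'k::field"
  assumes p: "\<exists>a\<in>Poly_Mapping.keys p. Poly_Mapping.keys a \<inter> C = {}"
    and q: "\<exists>b\<in>Poly_Mapping.keys q. Poly_Mapping.keys b \<inter> C = {}"
  shows "\<exists>m\<in>Poly_Mapping.keys (p * q). Poly_Mapping.keys m \<inter> C = {}"
proof -
  let ?avoid = "\<lambda>r. {m \<in> Poly_Mapping.keys r. Poly_Mapping.keys m \<inter> C = {}}"
  let ?S = "\<Union>(Poly_Mapping.keys ` (Poly_Mapping.keys p \<union> Poly_Mapping.keys q))"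
  have "\<exists>a\<in>?avoid p. \<exists>b\<in>?avoid q. \<forall>a'\<in>?avoid p. \<forall>b'\<in>?avoid q.
      a' + b' = a + b \<longrightarrow> a' = a \<and> b' = b"
  proof (rule unique_product_of_exponents[where S = ?S])
    show "?avoid p \<noteq> {}" "?avoid q \<noteq> {}"
      using p q by blast+
  qed (auto simp: in_keys_iff)
  then obtain a b where ab: "a \<in> ?avoid p" "b \<in> ?avoid q"
    and uniq: "\<And>a' b'. a' \<in> ?avoid p \<Longrightarrow> b' \<in> ?avoid q \<Longrightarrow> a' + b' = a + b \<Longrightarrow> a' = a"
    by blast
  have avoid: "Poly_Mapping.keys (a + b) \<inter> C = {}"
    using ab by (auto simp: keys_add_exponents)
  have "a' = a" if "a' \<in> Poly_Mapping.keys p" "b' \<in> Poly_Mapping.keys q" "a' + b' = a + b" for a' b'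
  proof (rule uniq[OF _ _ that(3)])
    \<comment> \<open>exponents do not cancel, so the factors of a monomial that avoids \<open>C\<close> avoid \<open>C\<close>\<close>
    have "Poly_Mapping.keys a' \<union> Poly_Mapping.keys b' = Poly_Mapping.keys (a + b)"
      using that(3) by (metis keys_add_exponents)
    then show "a' \<in> ?avoid p" "b' \<in> ?avoid q"
      using that avoid by auto
  qed
  then have "Poly_Mapping.lookup (p * q) (a + b) =
      Poly_Mapping.lookup p a * Poly_Mapping.lookup q b"
    by (rule lookup_mult_of_unique_product)
  then have "a + b \<in> Poly_Mapping.keys (p * q)"
    using ab by (simp add: in_keys_iff)
  then show ?thesis
    using avoid by blast
qed


section \<open>The primes of vertex sets\<close>

lemma mpoly_ring_simps:
  "carrier (mpoly_ring V) = {p. \<forall>m\<in>Poly_Mapping.keys p. Poly_Mapping.keys m \<subseteq> V}"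
  "p \<otimes>\<^bsub>mpoly_ring V\<^esub> q = p * q" "p \<oplus>\<^bsub>mpoly_ring V\<^esub> q = p + q"
  "\<zero>\<^bsub>mpoly_ring V\<^esub> = 0" "\<one>\<^bsub>mpoly_ring V\<^esub> = 1"
  by (simp_all add: mpoly_ring_def)

lemma ring_mpoly_ring: "ring (mpoly_ring V :: (('v \<Rightarrow>\<^sub>0 nat) \<Rightarrow>\<^sub>0 'k::field) ring)"
  using cring_mpoly_ring by (rule cring.axioms(1))

lemma mult_in_mpoly_ring:
  "p \<in> carrier (mpoly_ring V) \<Longrightarrow> q \<in> carrier (mpoly_ring V) \<Longrightarrow> p * q \<in> carrier (mpoly_ring V)"
  using ring.ring_simprules(5)[OF ring_mpoly_ring, of p V q] by (simp add: mpoly_ring_simps(2))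

definition cover_prime :: "'v set \<Rightarrow> 'v set \<Rightarrow> (('v \<Rightarrow>\<^sub>0 nat) \<Rightarrow>\<^sub>0 'k::field) set" where
  "cover_prime V C =
    {p \<in> carrier (mpoly_ring V). \<forall>m\<in>Poly_Mapping.keys p. Poly_Mapping.keys m \<inter> C \<noteq> {}}"

lemma ideal_cover_prime:
  "ideal (cover_prime V C :: (('v \<Rightarrow>\<^sub>0 nat) \<Rightarrow>\<^sub>0 'k::field) set) (mpoly_ring V)"
proof (rule idealI)
  let ?R = "mpoly_ring V :: (('v \<Rightarrow>\<^sub>0 nat) \<Rightarrow>\<^sub>0 'k) ring"
  let ?P = "cover_prime V C :: (('v \<Rightarrow>\<^sub>0 nat) \<Rightarrow>\<^sub>0 'k) set"
  interpret R: ring ?R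
    by (rule ring_mpoly_ring)
  show "ring ?R"
    by (rule ring_mpoly_ring)
  show mult: "r \<otimes>\<^bsub>?R\<^esub> p \<in> ?P" if "p \<in> ?P" "r \<in> carrier ?R" for p r
  proof -
    have "Poly_Mapping.keys m \<inter> C \<noteq> {}" if m: "m \<in> Poly_Mapping.keys (r * p)" for m
    proof -
      obtain a b where "a \<in> Poly_Mapping.keys r" "b \<in> Poly_Mapping.keys p" "m = a + b"
        using keys_multE[OF m] by blast
      then show ?thesis
        using \<open>p \<in> ?P\<close> by (auto simp: cover_prime_def keys_add_exponents)
    qed
    then show ?thesis
      using that mult_in_mpoly_ring[of r V p] by (simp add: cover_prime_def mpoly_ring_simps(2))
  qed
  then show "p \<otimes>\<^bsub>?R\<^esub> r \<in> ?P" if "p \<in> ?P" "r \<in> carrier ?R" for p r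
    using that by (simp add: mpoly_ring_simps(2) mult.commute)
  show "subgroup ?P (add_monoid ?R)"
  proof (rule R.add.subgroupI)
    show "?P \<noteq> {}"
      by (auto simp: cover_prime_def mpoly_ring_simps intro!: exI[of _ 0])
    show "\<ominus>\<^bsub>?R\<^esub> p \<in> ?P" if "p \<in> ?P" for p
    proof -
      have "\<ominus>\<^bsub>?R\<^esub> p = (\<ominus>\<^bsub>?R\<^esub> \<one>\<^bsub>?R\<^esub>) \<otimes>\<^bsub>?R\<^esub> p"
        using that by (simp add: R.l_minus cover_prime_def)
      then show ?thesis
        using mult[OF that] by simp
    qed
    show "p \<oplus>\<^bsub>?R\<^esub> q \<in> ?P" if "p \<in> ?P" "q \<in> ?P" for p q
      using that R.add.m_closed[of p q] keys_add[of p q]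
      by (auto simp: cover_prime_def mpoly_ring_simps(3))
  qed (auto simp: cover_prime_def)
qed

lemma primeideal_cover_prime:
  "primeideal (cover_prime V C :: (('v \<Rightarrow>\<^sub>0 nat) \<Rightarrow>\<^sub>0 'k::field) set) (mpoly_ring V)"
proof (rule primeidealI[OF ideal_cover_prime cring_mpoly_ring])
  have "(1 :: ('v \<Rightarrow>\<^sub>0 nat) \<Rightarrow>\<^sub>0 'k) \<in> carrier (mpoly_ring V)" "1 \<notin> cover_prime V C"
    by (auto simp: cover_prime_def mpoly_ring_simps)
  then show "carrier (mpoly_ring V) \<noteq> (cover_prime V C :: (('v \<Rightarrow>\<^sub>0 nat) \<Rightarrow>\<^sub>0 'k) set)"
    by blast
next
  fix p q :: "('v \<Rightarrow>\<^sub>0 nat) \<Rightarrow>\<^sub>0 'k"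
  assume "p \<in> carrier (mpoly_ring V)" "q \<in> carrier (mpoly_ring V)"
    and "p \<otimes>\<^bsub>mpoly_ring V\<^esub> q \<in> cover_prime V C"
  then show "p \<in> cover_prime V C \<or> q \<in> cover_prime V C"
    using keys_mult_avoiding[of p C q] by (auto simp: cover_prime_def mpoly_ring_simps(2))
qed

lemma cover_prime_multD:
  assumes "p * q \<in> cover_prime V C" "p \<in> carrier (mpoly_ring V)" "q \<in> carrier (mpoly_ring V)"
    and "q \<notin> cover_prime V C"
  shows "p \<in> cover_prime V C"
  using primeideal.I_prime[OF primeideal_cover_prime, of p V q C] assms
  by (simp add: mpoly_ring_simps(2))

lemma poly_var_mult:
  "poly_var u * poly_var v =
    Poly_Mapping.single (Poly_Mapping.single u 1 + Poly_Mapping.single v 1) 1"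
  by (simp add: poly_var_def mult_single)

lemma poly_var_in_cover_prime:
  "v \<in> C \<Longrightarrow> v \<in> V \<Longrightarrow> poly_var v \<in> cover_prime V C"
  using poly_var_in_carrier[of v V] by (auto simp: cover_prime_def poly_var_def)

lemma poly_var_combination_in_cover_primeD:
  fixes p :: "('v \<Rightarrow>\<^sub>0 nat) \<Rightarrow>\<^sub>0 'k::field"
  assumes "p = poly_var x + poly_var y \<or> p = poly_var x - poly_var y" and "x \<noteq> y"
    and p: "p \<in> cover_prime V C"
  shows "x \<in> C" "y \<in> C"
proof -
  have ne: "(Poly_Mapping.single x 1 :: 'v \<Rightarrow>\<^sub>0 nat) \<noteq> Poly_Mapping.single y 1"
  proof
    assume "(Poly_Mapping.single x 1 :: 'v \<Rightarrow>\<^sub>0 nat) = Poly_Mapping.single y 1"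
    then have "Poly_Mapping.lookup (Poly_Mapping.single x (1::nat)) x =
        Poly_Mapping.lookup (Poly_Mapping.single y 1) x"
      by simp
    then show False
      using \<open>x \<noteq> y\<close> by (simp add: lookup_single)
  qed
  \<comment> \<open>the coefficients are \<open>1\<close> and \<open>-1\<close>, which are nonzero in every characteristic\<close>
  have "Poly_Mapping.single x 1 \<in> Poly_Mapping.keys p"
    "Poly_Mapping.single y 1 \<in> Poly_Mapping.keys p"
    using assms(1) ne ne[symmetric]
    by (auto simp: in_keys_iff poly_var_def lookup_add lookup_minus lookup_single when_def)
  then show "x \<in> C" "y \<in> C"
    using p by (auto simp: cover_prime_def)
qed

text \<open>
  Every monomial of an element of \<open>P\<^sub>C\<^sup>2\<close> is divisible by a product of two variables
  in \<open>C\<close>, which for \<open>xy\<close> can only be \<open>xy\<close> itself.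
\<close>

lemma poly_var_mult_in_cover_prime_squareD:
  fixes Q :: "(('v \<Rightarrow>\<^sub>0 nat) \<Rightarrow>\<^sub>0 'k::field) set"
  assumes Q: "Q \<subseteq> cover_prime V C" and "x \<noteq> y"
    and xy: "poly_var x * poly_var y \<in> Q \<cdot>\<^bsub>mpoly_ring V\<^esub> Q"
  shows "x \<in> C" "y \<in> C"
proof -
  have split: "\<forall>m\<in>Poly_Mapping.keys p. \<exists>a b. m = a + b \<and>
      Poly_Mapping.keys a \<inter> C \<noteq> {} \<and> Poly_Mapping.keys b \<inter> C \<noteq> {}"
    if "p \<in> Q \<cdot>\<^bsub>mpoly_ring V\<^esub> Q" for p
    using that
  proof induction
    case (prod i j)
    show ?case
    proof
      fix m assume "m \<in> Poly_Mapping.keys (i \<otimes>\<^bsub>mpoly_ring V\<^esub> j)"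
      then obtain a b where "a \<in> Poly_Mapping.keys i" "b \<in> Poly_Mapping.keys j" "m = a + b"
        by (metis keys_multE mpoly_ring_simps(2))
      then show "\<exists>a b. m = a + b \<and> Poly_Mapping.keys a \<inter> C \<noteq> {} \<and> Poly_Mapping.keys b \<inter> C \<noteq> {}"
        using prod Q unfolding cover_prime_def by blast
    qed
  next
    case (sum p q)
    then show ?case
      using keys_add[of p q] unfolding mpoly_ring_simps(3) by blast
  qed
  let ?m = "Poly_Mapping.single x 1 + Poly_Mapping.single y 1 :: 'v \<Rightarrow>\<^sub>0 nat"
  have "?m \<in> Poly_Mapping.keys (poly_var x * poly_var y :: ('v \<Rightarrow>\<^sub>0 nat) \<Rightarrow>\<^sub>0 'k)"
    by (simp add: poly_var_mult)
  then obtain a b where ab: "?m = a + b"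
    "Poly_Mapping.keys a \<inter> C \<noteq> {}" "Poly_Mapping.keys b \<inter> C \<noteq> {}"
    using split[OF xy] by blast
  then obtain u v where uv: "u \<in> Poly_Mapping.keys a" "u \<in> C" "v \<in> Poly_Mapping.keys b" "v \<in> C"
    by blast
  have "Poly_Mapping.keys a \<union> Poly_Mapping.keys b = {x, y}"
    using arg_cong[OF ab(1), of Poly_Mapping.keys] by (auto simp: keys_add_exponents)
  then have in_xy: "u \<in> {x, y}" "v \<in> {x, y}"
    using uv by blast+
  have "u \<noteq> v"
  proof
    assume "u = v"
    then have "Poly_Mapping.lookup (a + b) u \<ge> 2"
      using uv by (simp add: lookup_add in_keys_iff)
    moreover have "Poly_Mapping.lookup ?m u = 1"
      using in_xy(1) \<open>x \<noteq> y\<close> by (auto simp: lookup_add lookup_single when_def)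
    ultimately show False
      using ab(1) by simp
  qed
  then show "x \<in> C" "y \<in> C"
    using in_xy uv by auto
qed


section \<open>The edge ideal as an intersection of primes\<close>

lemma edge_generators_in_carrier:
  assumes "simple_graph V E"
  shows "{poly_var u * poly_var v | u v. {u, v} \<in> E} \<subseteq> carrier (mpoly_ring V)"
  using simple_graph_edgeD[OF assms] by (auto intro!: mult_in_mpoly_ring poly_var_in_carrier)

lemma ideal_edge_ideal: "simple_graph V E \<Longrightarrow> ideal (edge_ideal V E) (mpoly_ring V)"
  unfolding edge_ideal_def
  by (intro ring.genideal_ideal ring_mpoly_ring edge_generators_in_carrier)

lemma edge_ideal_subset_cover_prime:
  assumes G: "simple_graph V E" and C: "vertex_cover V E C"
  shows "edge_ideal V E \<subseteq> cover_prime V C"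
  unfolding edge_ideal_def
proof (rule ring.genideal_minimal[OF ring_mpoly_ring ideal_cover_prime])
  have "poly_var u * poly_var v \<in> cover_prime V C" if "{u, v} \<in> E" for u v
    using vertex_cover_edgeD[OF C that] simple_graph_edgeD[OF G that]
      mult_in_mpoly_ring[OF poly_var_in_carrier poly_var_in_carrier, of u V v]
    by (auto simp: cover_prime_def poly_var_mult keys_add_exponents)
  then show "{poly_var u * poly_var v | u v. {u, v} \<in> E} \<subseteq> cover_prime V C"
    by blast
qed

lemma monomial_in_edge_ideal:
  fixes m :: "'v \<Rightarrow>\<^sub>0 nat" and c :: "'k::field"
  assumes G: "simple_graph V E" and e: "{u, v} \<in> E"
    and m: "{u, v} \<subseteq> Poly_Mapping.keys m" "Poly_Mapping.keys m \<subseteq> V"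
  shows "Poly_Mapping.single m c \<in> edge_ideal V E"
proof -
  let ?uv = "Poly_Mapping.single u 1 + Poly_Mapping.single v 1 :: 'v \<Rightarrow>\<^sub>0 nat"
  have "m - ?uv + ?uv = m"
  proof (rule poly_mapping_eqI)
    fix w
    have "Poly_Mapping.lookup ?uv w \<le> Poly_Mapping.lookup m w"
      using m(1) simple_graph_edgeD(1)[OF G e]
      by (auto simp: lookup_add lookup_single when_def in_keys_iff Suc_le_eq)
    then show "Poly_Mapping.lookup (m - ?uv + ?uv) w = Poly_Mapping.lookup m w"
      by (simp add: lookup_add lookup_minus)
  qed
  then have factor: "Poly_Mapping.single m c =
      Poly_Mapping.single (m - ?uv) c * (poly_var u * poly_var v)"
    by (simp only: poly_var_mult mult_single mult_1_right)
  have "Poly_Mapping.keys (m - ?uv) \<subseteq> Poly_Mapping.keys m"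
    by (auto simp: in_keys_iff lookup_minus)
  then have "Poly_Mapping.single (m - ?uv) c \<in> carrier (mpoly_ring V)"
    using m(2) by (auto simp: mpoly_ring_simps(1) split: if_splits)
  moreover have "poly_var u * poly_var v \<in> edge_ideal V E"
    using ring.genideal_self[OF ring_mpoly_ring edge_generators_in_carrier[OF G]] e
    unfolding edge_ideal_def by blast
  ultimately show ?thesis
    unfolding factor using ideal.I_l_closed[OF ideal_edge_ideal[OF G]]
    by (simp add: mpoly_ring_simps(2))
qed

lemma edge_idealI:
  fixes p :: "('v \<Rightarrow>\<^sub>0 nat) \<Rightarrow>\<^sub>0 'k::field"
  assumes G: "simple_graph V E" and p: "p \<in> carrier (mpoly_ring V)"
    and edges: "\<And>m. m \<in> Poly_Mapping.keys p \<Longrightarrow> \<exists>u v. {u, v} \<in> E \<and> {u, v} \<subseteq> Poly_Mapping.keys m"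
  shows "p \<in> edge_ideal V E"
proof -
  let ?term = "\<lambda>m. Poly_Mapping.single m (Poly_Mapping.lookup p m)"
  note I = ideal.axioms(1)[OF ideal_edge_ideal[OF G]]
  have sum_in: "(\<Sum>m\<in>F. ?term m) \<in> edge_ideal V E" if "F \<subseteq> Poly_Mapping.keys p" for F
    using finite_subset[OF that finite_keys] that
  proof (induction F rule: finite_induct)
    case empty
    then show ?case
      using additive_subgroup.zero_closed[OF I] by (simp add: mpoly_ring_simps(4))
  next
    case (insert m F)
    have m: "m \<in> Poly_Mapping.keys p"
      using insert.prems by blast
    have "?term m \<in> edge_ideal V E"
      using edges[OF m] p m monomial_in_edge_ideal[OF G, where m = m and c = "Poly_Mapping.lookup p m"]
      by (auto simp: mpoly_ring_simps(1))
    then show ?case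
      using insert additive_subgroup.a_closed[OF I] by (simp add: mpoly_ring_simps(3))
  qed
  have "p = (\<Sum>m\<in>Poly_Mapping.keys p. ?term m)"
    by (rule poly_mapping_eqI) (simp add: lookup_sum lookup_single when_def in_keys_iff)
  then show ?thesis
    using sum_in[OF order_refl] by simp
qed

text \<open>
  Some monomial of \<open>f\<close> is divisible by no edge. Its support is independent, so the complement of the
  support is a cover.
\<close>

lemma not_in_edge_ideal_imp_minimal_cover:
  assumes G: "simple_graph V E" and f: "f \<in> carrier (mpoly_ring V)" "f \<notin> edge_ideal V E"
  obtains C where "minimal_vertex_cover V E C" "f \<notin> cover_prime V C"
proof -
  obtain m where m: "m \<in> Poly_Mapping.keys f"
    and indep: "\<And>u v. {u, v} \<in> E \<Longrightarrow> \<not> {u, v} \<subseteq> Poly_Mapping.keys m"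
    using edge_idealI[OF G f(1)] f(2) by blast
  have "\<exists>w\<in>V - Poly_Mapping.keys m. w \<in> e" if e: "e \<in> E" for e
  proof -
    obtain u v where "e = {u, v}" "u \<in> V" "v \<in> V"
      using simple_graph_edge[OF G e] by blast
    then show ?thesis
      using indep[of u v] e by blast
  qed
  then have "vertex_cover V E (V - Poly_Mapping.keys m)"
    by (auto simp: vertex_cover_def)
  then obtain C where "minimal_vertex_cover V E C" "C \<subseteq> V - Poly_Mapping.keys m"
    using vertex_cover_contains_minimal[OF G] by blast
  then show ?thesis
    using m by (intro that[of C]) (auto simp: cover_prime_def)
qed

text \<open>
  This is the product of the variables outside \<open>C\<close>, the element of \<open>R/I\<close> whose annihilator is \<open>P\<^sub>C\<close>
  when \<open>C\<close> is a minimal cover.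
\<close>

definition complement_monomial :: "'v set \<Rightarrow> 'v set \<Rightarrow> ('v \<Rightarrow>\<^sub>0 nat) \<Rightarrow>\<^sub>0 'k::field" where
  "complement_monomial V C = Poly_Mapping.single (\<Sum>v\<in>V - C. Poly_Mapping.single v 1) 1"

lemma complement_monomial_keys:
  fixes V :: "'v set"
  assumes "finite V"
  obtains m where "(complement_monomial V C :: _ \<Rightarrow>\<^sub>0 'k::field) = Poly_Mapping.single m 1"
    "Poly_Mapping.keys m = V - C"
proof
  have lookup_support: "Poly_Mapping.lookup (\<Sum>v\<in>V - C. Poly_Mapping.single v 1 :: 'v \<Rightarrow>\<^sub>0 nat) w =
      (if w \<in> V - C then 1 else 0)" for w
    using assms by (simp add: lookup_sum lookup_single when_def)
  show "Poly_Mapping.keys (\<Sum>v\<in>V - C. Poly_Mapping.single v 1 :: 'v \<Rightarrow>\<^sub>0 nat) = V - C"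
    by (rule Set.set_eqI) (simp only: in_keys_iff lookup_support, simp)
qed (simp add: complement_monomial_def)

lemma complement_monomial_props:
  fixes V :: "'v set"
  assumes "finite V"
  shows "(complement_monomial V C :: _ \<Rightarrow>\<^sub>0 'k::field) \<in> carrier (mpoly_ring V)"
    and "(complement_monomial V C :: _ \<Rightarrow>\<^sub>0 'k) \<notin> cover_prime V C"
proof -
  obtain m where "(complement_monomial V C :: _ \<Rightarrow>\<^sub>0 'k) = Poly_Mapping.single m 1"
    "Poly_Mapping.keys m = V - C"
    using complement_monomial_keys[OF assms] by blast
  then show "(complement_monomial V C :: _ \<Rightarrow>\<^sub>0 'k) \<in> carrier (mpoly_ring V)"
    "(complement_monomial V C :: _ \<Rightarrow>\<^sub>0 'k) \<notin> cover_prime V C"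
    by (auto simp: cover_prime_def mpoly_ring_simps(1))
qed

text \<open>
  A monomial involving some \<open>v \<in> C\<close> becomes divisible by an edge after multiplication with all
  variables outside \<open>C\<close>, since minimality gives \<open>v\<close> a neighbour there. The converse is primality
  of \<open>P\<^sub>C\<close>.
\<close>

lemma annihilator_of_complement_monomial:
  fixes r :: "('v \<Rightarrow>\<^sub>0 nat) \<Rightarrow>\<^sub>0 'k::field"
  assumes G: "simple_graph V E" and min: "minimal_vertex_cover V E C"
    and r: "r \<in> carrier (mpoly_ring V)"
  shows "r * complement_monomial V C \<in> edge_ideal V E \<longleftrightarrow> r \<in> cover_prime V C"
proof
  have fin: "finite V"
    using G by (simp add: simple_graph_def)
  note mon = complement_monomial_props[OF fin, of C, where 'k = 'k]
  have C: "vertex_cover V E C" "\<And>v. v \<in> C \<Longrightarrow> \<exists>u\<in>V - C. {u, v} \<in> E"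
    using min minimal_vertex_cover_iff_private_edge[OF G] by blast+
  show "r \<in> cover_prime V C" if "r * complement_monomial V C \<in> edge_ideal V E"
    using that edge_ideal_subset_cover_prime[OF G C(1)] cover_prime_multD[OF _ r mon] by blast
  assume rC: "r \<in> cover_prime V C"
  obtain m where m: "complement_monomial V C = Poly_Mapping.single m (1 :: 'k)"
    "Poly_Mapping.keys m = V - C"
    using complement_monomial_keys[OF fin] by blast
  show "r * complement_monomial V C \<in> edge_ideal V E"
  proof (rule edge_idealI[OF G mult_in_mpoly_ring[OF r mon(1)]])
    fix k assume "k \<in> Poly_Mapping.keys (r * complement_monomial V C)"
    then obtain a b where "a \<in> Poly_Mapping.keys r"
      "b \<in> Poly_Mapping.keys (complement_monomial V C :: ('v \<Rightarrow>\<^sub>0 nat) \<Rightarrow>\<^sub>0 'k)" "k = a + b"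
      by (rule keys_multE)
    then have a: "a \<in> Poly_Mapping.keys r" "k = a + m"
      by (simp_all add: m(1))
    obtain v where v: "v \<in> Poly_Mapping.keys a" "v \<in> C"
      using rC a(1) unfolding cover_prime_def by blast
    obtain u where u: "u \<in> V - C" "{u, v} \<in> E"
      using C(2)[OF v(2)] by blast
    have "{u, v} \<subseteq> Poly_Mapping.keys k"
      using u v by (simp add: a(2) keys_add_exponents m(2))
    then show "\<exists>u v. {u, v} \<in> E \<and> {u, v} \<subseteq> Poly_Mapping.keys k"
      using u(2) by blast
  qed
qed


section \<open>Regular elements and associated primes of the quotient\<close>

lemma (in ideal) rcos_eq_self_iff:
  "r \<in> carrier R \<Longrightarrow> I +> r = I \<longleftrightarrow> r \<in> I"
  using a_rcos_self[of r] a_rcos_const[of r] by auto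

lemma (in ideal) carrier_quot: "carrier (R Quot I) = (\<lambda>r. I +> r) ` carrier R"
  by (auto simp: FactRing_simps)

lemma (in ideal) quot_mult_eq_zero_iff:
  assumes "r \<in> carrier R" "s \<in> carrier R"
  shows "(I +> r) \<otimes>\<^bsub>R Quot I\<^esub> (I +> s) = \<zero>\<^bsub>R Quot I\<^esub> \<longleftrightarrow> r \<otimes> s \<in> I"
  using assms by (simp add: FactRing_def rcoset_mult_add rcos_eq_self_iff)

lemma (in ideal) regular_element_quot_iff:
  assumes "s \<in> carrier R"
  shows "regular_element (R Quot I) (I +> s) \<longleftrightarrow> (\<forall>r\<in>carrier R. s \<otimes> r \<in> I \<longrightarrow> r \<in> I)"
proof -
  have "I +> r = \<zero>\<^bsub>R Quot I\<^esub> \<longleftrightarrow> r \<in> I" if "r \<in> carrier R" for r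
    using rcos_eq_self_iff[OF that] by (simp add: FactRing_def)
  then show ?thesis
    using assms by (auto simp: regular_element_def carrier_quot quot_mult_eq_zero_iff)
qed

lemma (in ideal) associated_prime_quot_iff:
  "associated_prime R (quot_module R I) Q \<longleftrightarrow>
    primeideal Q R \<and> (\<exists>f\<in>carrier R. Q = {r \<in> carrier R. r \<otimes> f \<in> I})"
proof -
  have "{r \<in> carrier R. (I +> r) \<otimes>\<^bsub>R Quot I\<^esub> (I +> f) = \<zero>\<^bsub>R Quot I\<^esub>} =
      {r \<in> carrier R. r \<otimes> f \<in> I}" if "f \<in> carrier R" for f
    using that quot_mult_eq_zero_iff by blast
  then show ?thesis
    by (simp add: associated_prime_def quot_module_def carrier_quot)
qed

text \<open>
  The zero divisors on \<open>R/I\<close> are the elements of the \<open>P\<^sub>C\<close> for minimal covers \<open>C\<close>, and \<open>x + y\<close> or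
  \<open>x - y\<close> lies in \<open>P\<^sub>C\<close> iff \<open>x\<close> and \<open>y\<close> lie in \<open>C\<close>.
\<close>

lemma regular_in_edge_ideal_quotient_iff:
  fixes V :: "'v set" and R :: "(('v \<Rightarrow>\<^sub>0 nat) \<Rightarrow>\<^sub>0 'k::field) ring"
  assumes G: "simple_graph V E" and xy: "x \<in> V" "y \<in> V" "x \<noteq> y"
    and R: "R = mpoly_ring V" and I: "I = edge_ideal V E"
  shows "regular_element (R Quot I) (I +>\<^bsub>R\<^esub> (poly_var x + poly_var y)) \<and>
      regular_element (R Quot I) (I +>\<^bsub>R\<^esub> (poly_var x - poly_var y)) \<longleftrightarrow>
    \<not> (\<exists>C. minimal_vertex_cover V E C \<and> {x, y} \<subseteq> C)"
proof -
  interpret ideal I R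
    unfolding R I by (rule ideal_edge_ideal[OF G])
  let ?plus = "poly_var x + poly_var y :: ('v \<Rightarrow>\<^sub>0 nat) \<Rightarrow>\<^sub>0 'k"
  let ?minus = "poly_var x - poly_var y :: ('v \<Rightarrow>\<^sub>0 nat) \<Rightarrow>\<^sub>0 'k"
  have vars: "Poly_Mapping.keys ?plus \<subseteq> {Poly_Mapping.single x 1, Poly_Mapping.single y 1}"
    "Poly_Mapping.keys ?minus \<subseteq> {Poly_Mapping.single x 1, Poly_Mapping.single y 1}"
    by (auto simp: in_keys_iff poly_var_def lookup_add lookup_minus lookup_single when_def
        split: if_splits)
  have carr: "?plus \<in> carrier R" "?minus \<in> carrier R"
    using vars xy by (fastforce simp: R mpoly_ring_simps(1))+
  have not_regular: "\<not> regular_element (R Quot I) (I +>\<^bsub>R\<^esub> ?plus)"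
    if min: "minimal_vertex_cover V E C" and "{x, y} \<subseteq> C" for C
  proof -
    have "?plus \<in> cover_prime V C"
      using carr(1) vars(1) that(2) by (fastforce simp: cover_prime_def R)
    then have "?plus * complement_monomial V C \<in> I"
      using annihilator_of_complement_monomial[OF G min, of ?plus] carr(1) by (simp add: I R)
    moreover have "complement_monomial V C \<notin> I"
      using edge_ideal_subset_cover_prime[OF G, of C] min G complement_monomial_props(2)[of V C]
      by (auto simp: I simple_graph_def minimal_vertex_cover_def)
    moreover have "complement_monomial V C \<in> carrier R"
      using G complement_monomial_props(1)[of V C] by (simp add: R simple_graph_def)
    ultimately show ?thesis
      using regular_element_quot_iff[OF carr(1)] by (auto simp: R mpoly_ring_simps(2))
  qed
  have regular: "regular_element (R Quot I) (I +>\<^bsub>R\<^esub> p)"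
    if p: "p = ?plus \<or> p = ?minus" and none: "\<not> (\<exists>C. minimal_vertex_cover V E C \<and> {x, y} \<subseteq> C)" for p
  proof -
    have pR: "p \<in> carrier R"
      using p carr by blast
    have "f \<in> I" if f: "f \<in> carrier R" "p * f \<in> I" for f
    proof (rule ccontr)
      assume "f \<notin> I"
      then obtain C where C: "minimal_vertex_cover V E C" "f \<notin> cover_prime V C"
        using not_in_edge_ideal_imp_minimal_cover[OF G] f(1) unfolding I R by blast
      have "p * f \<in> cover_prime V C"
        using f(2) C(1) edge_ideal_subset_cover_prime[OF G]
        by (auto simp: I minimal_vertex_cover_def)
      then have "p \<in> cover_prime V C"
        using cover_prime_multD pR f(1) C(2) unfolding R by blast
      then show False
        using poly_var_combination_in_cover_primeD[OF p xy(3)] C(1) none by blast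
    qed
    then show ?thesis
      using regular_element_quot_iff[OF pR] by (simp add: R mpoly_ring_simps(2))
  qed
  show ?thesis
    using regular not_regular by blast
qed

text \<open>
  Every \<open>P\<^sub>C\<close> with \<open>C\<close> a minimal cover is an associated prime. In the other direction it is enough
  that an associated prime is contained in some \<open>P\<^sub>C\<close>, because \<open>Q\<^sup>2 \<subseteq> P\<^sub>C\<^sup>2\<close> for \<open>Q \<subseteq> P\<^sub>C\<close>.
\<close>

lemma associated_primes_of_edge_ideal_iff:
  fixes V :: "'v set" and R :: "(('v \<Rightarrow>\<^sub>0 nat) \<Rightarrow>\<^sub>0 'k::field) ring"
  assumes G: "simple_graph V E" and xy: "x \<in> V" "y \<in> V" "x \<noteq> y"
    and R: "R = mpoly_ring V" and I: "I = edge_ideal V E"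
  shows "(\<forall>Q. associated_prime R (quot_module R I) Q \<longrightarrow>
      poly_var x * poly_var y \<notin> Q \<cdot>\<^bsub>R\<^esub> Q) \<longleftrightarrow>
    \<not> (\<exists>C. minimal_vertex_cover V E C \<and> {x, y} \<subseteq> C)"
proof -
  interpret ideal I R
    unfolding R I by (rule ideal_edge_ideal[OF G])
  have bad_prime: "\<exists>Q. associated_prime R (quot_module R I) Q \<and>
      poly_var x * poly_var y \<in> Q \<cdot>\<^bsub>R\<^esub> Q"
    if min: "minimal_vertex_cover V E C" and "{x, y} \<subseteq> C" for C
  proof (intro exI conjI)
    let ?P = "cover_prime V C :: (('v \<Rightarrow>\<^sub>0 nat) \<Rightarrow>\<^sub>0 'k) set"
    have "?P = {r \<in> carrier R. r \<otimes>\<^bsub>R\<^esub> complement_monomial V C \<in> I}"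
      using annihilator_of_complement_monomial[OF G min]
      by (auto simp: R I mpoly_ring_simps(2) cover_prime_def)
    moreover have "complement_monomial V C \<in> carrier R"
      using G complement_monomial_props(1)[of V C] by (simp add: R simple_graph_def)
    moreover have "primeideal ?P R"
      by (simp add: R primeideal_cover_prime)
    ultimately show "associated_prime R (quot_module R I) ?P"
      unfolding associated_prime_quot_iff by blast
    have "poly_var x \<in> ?P" "poly_var y \<in> ?P"
      using that(2) xy by (auto intro: poly_var_in_cover_prime)
    then show "poly_var x * poly_var y \<in> ?P \<cdot>\<^bsub>R\<^esub> ?P"
      using ideal_prod.prod[of "poly_var x" ?P "poly_var y" ?P R] by (simp add: R mpoly_ring_simps(2))
  qed
  have bad_cover: "\<exists>C. minimal_vertex_cover V E C \<and> {x, y} \<subseteq> C"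
    if Q: "associated_prime R (quot_module R I) Q" and xyQ: "poly_var x * poly_var y \<in> Q \<cdot>\<^bsub>R\<^esub> Q" for Q
  proof -
    obtain f where prime: "primeideal Q R" and f: "f \<in> carrier R"
      and ann: "Q = {r \<in> carrier R. r \<otimes>\<^bsub>R\<^esub> f \<in> I}"
      using Q associated_prime_quot_iff by blast
    have "f \<notin> I"
    proof
      assume "f \<in> I"
      then have "Q = carrier R"
        unfolding ann using I_l_closed by blast
      then show False
        using primeideal.I_notcarr[OF prime] by simp
    qed
    then obtain C where C: "minimal_vertex_cover V E C" "f \<notin> cover_prime V C"
      using not_in_edge_ideal_imp_minimal_cover[OF G] f unfolding I R by blast
    have "I \<subseteq> cover_prime V C"
      using C(1) by (simp add: I minimal_vertex_cover_def edge_ideal_subset_cover_prime[OF G])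
    then have "Q \<subseteq> cover_prime V C"
      using cover_prime_multD[OF _ _ _ C(2)] f
      unfolding ann R I mpoly_ring_simps(2) by blast
    then have "x \<in> C" "y \<in> C"
      using poly_var_mult_in_cover_prime_squareD[OF _ xy(3)] xyQ unfolding R by blast+
    then show ?thesis
      using C(1) by blast
  qed
  show ?thesis
    using bad_prime bad_cover by blast
qed


section \<open>The equivalences\<close>

theorem theorem6p1:
  fixes V :: "'v set" and E E' :: "'v set set" and x y :: 'v
    and R :: "(('v \<Rightarrow>\<^sub>0 nat) \<Rightarrow>\<^sub>0 'k::field) ring"
    and I I' :: "(('v \<Rightarrow>\<^sub>0 nat) \<Rightarrow>\<^sub>0 'k) set"
  assumes "simple_graph V E"
    and "x \<in> V" and "y \<in> V" and "x \<noteq> y" and "{x, y} \<notin> E"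
    and "E' = E \<union> {{x, y}}"
    and "R = mpoly_ring V"
    and "I = edge_ideal V E" and "I' = edge_ideal V E'"
  shows "all_equivalent
    [property_P V E' x y,
     regular_element (R Quot I) (I +>\<^bsub>R\<^esub> (poly_var x + poly_var y)) \<and>
       regular_element (R Quot I) (I +>\<^bsub>R\<^esub> (poly_var x - poly_var y)),
     regular_element (R Quot I') (I' +>\<^bsub>R\<^esub> (poly_var x + poly_var y)) \<and>
       regular_element (R Quot I') (I' +>\<^bsub>R\<^esub> (poly_var x - poly_var y)),
     \<forall>Q. associated_prime R (quot_module R I) Q \<longrightarrow> poly_var x * poly_var y \<notin> Q \<cdot>\<^bsub>R\<^esub> Q,
     \<forall>Q. associated_prime R (quot_module R I') Q \<longrightarrow> poly_var x * poly_var y \<notin> Q \<cdot>\<^bsub>R\<^esub> Q,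
     \<not> (\<exists>C. minimal_vertex_cover V E C \<and> {x, y} \<subseteq> C),
     \<not> (\<exists>C. minimal_vertex_cover V E' C \<and> {x, y} \<subseteq> C)]"
proof -
  have E': "E' = insert {x, y} E"
    using assms(6) by blast
  have G': "simple_graph V E'"
    using assms(1-4) by (auto simp: E' simple_graph_def)
  have "{x, y} \<in> E'"
    by (simp add: E')
  note equivalences =
    property_P_iff_no_minimal_cover[OF G' this]
    regular_in_edge_ideal_quotient_iff[OF assms(1-4,7,8)]
    regular_in_edge_ideal_quotient_iff[OF G' assms(2-4,7,9)]
    associated_primes_of_edge_ideal_iff[OF assms(1-4,7,8)]
    associated_primes_of_edge_ideal_iff[OF G' assms(2-4,7,9)]
  show ?thesis
    unfolding equivalences
    using ex_minimal_cover_add_edge_iff[OF assms(1-4)] by (simp add: all_equivalent_def E')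
qed

end
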